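(* Consider the infinitely repeated game described in the context, let $a\in\mathcal N$ be a player and let $n\ge1$. Let $\hat T_a^{(1)}$ be the Press–Dyson vectors of a memory-one zero-determinant (ZD) strategy of player $a$ satisfying $$\sum_{\sigma_a}c_{\sigma_a}\hat T_a^{(1)}\left(\sigma_a|\bm\sigma^{(-1)}\right)=\sum_{b=0}^N\alpha_b s_b\left(\bm\sigma^{(-1)}\right)\qquad\left(\forall\bm\sigma^{(-1)}\in\mathcal A\right)$$ with some coefficients $\{c_{\sigma_a}\}$ and $\{\alpha_b\}$. Let $\hat{\bm\sigma}^{(-2)},\dots,\hat{\bm\sigma}^{(-n)}\in\mathcal A$ be some action profiles. Then a memory-$n$ strategy of player $a$ whose Press–Dyson tensor is $$\hat T_a\left(\sigma_a|\bm\sigma^{(-1)},\dots,\bm\sigma^{(-n)}\right)=\hat T_a^{(1)}\left(\sigma_a|\bm\sigma^{(-1)}\right)\prod_{m=2}^n\delta_{\bm\sigma^{(-m)},\hat{\bm\sigma}^{(-m)}}\qquad\left(\forall\sigma_a\in A_a,\ \forall\bm\sigma^{(-1)},\dots,\bm\sigma^{(-n)}\in\mathcal A\right)$$ unilaterally enforces either a linear relation between conditional expectations of payoffs when the history of the previous $n-1$ action profiles is $\hat{\bm\sigma}^{(-2)},\dots,\hat{\bm\sigma}^{(-n)}$, $$0=\sum_{b=0}^N\alpha_b\frac{\left\langle s_b\left(\bm\sigma^{(-1)}\right)\prod_{m=2}^n\delta_{\bm\sigma^{(-m)},\hat{\bm\sigma}^{(-m)}}\right\rangle^*}{\left\langle\prod_{m=2}^n\delta_{\bm\sigma^{(-m)},\hat{\bm\sigma}^{(-m)}}\right\rangle^*}$$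 (with nonzero denominator), or the relation $$0=\left\langle\prod_{m=2}^n\delta_{\bm\sigma^{(-m)},\hat{\bm\sigma}^{(-m)}}\right\rangle^*.$$
   Context: Game: the set of players is $\mathcal N=\{1,\dots,N\}$; player $a$ has the finite action set $A_a=\{1,\dots,M_a\}$; $\mathcal A=\prod_{a=1}^N A_a$ is the set of action profiles $\bm\sigma=(\sigma_1,\dots,\sigma_N)$; $s_b(\bm\sigma)\in\mathbb R$ is the one-shot payoff of player $b\in\mathcal N$, and $s_0(\bm\sigma):=1$ for all $\bm\sigma$. The game is repeated infinitely often; $\bm\sigma(t)$ is the action profile in round $t\ge 1$. A (behavior) strategy of player $a$ is a sequence $\{T_a^{(t)}\}_{t\ge1}$, where $T_a^{(t)}$ maps each history in $\mathcal A^{t-1}$ to a probability distribution on $A_a$. Given strategies of all players, the joint distribution of the first $t$ profiles is $$\mathbb P_t(\bm\sigma(t),\dots,\bm\sigma(1))=\prod_{t'=1}^t\prod_{b=1}^N T_b^{(t')}(\sigma_b(t')|\bm\sigma(t'-1),\dots,\bm\sigma(1)).$$ Memory-$n$ strategy: a strategy of player $a$ is a (time-independent) memory-$n$ strategy if there is a single conditional probability $T_a(\sigma_a|\bm\sigma^{(-1)},\dots,\bm\sigma^{(-n)})$ such that $T_a^{(t)}(\sigma_a(t)|\bm\sigma(t-1),\dots,\bm\sigma(1))=T_a(\sigma_a(t)|\bm\sigma(t-1),\dots,\bm\sigma(t-n))$ for all $t>n$, all $\sigma_a(t)$ and all histories. Its Press–Dyson tensor is $\hat T_a(\sigma_a|\bm\sigma^{(-1)},\dots,\bm\sigma^{(-n)})=T_a(\sigma_a|\bm\sigma^{(-1)},\dots,\bm\sigma^{(-n)})-\delta_{\sigma_a,\sigma_a^{(-1)}}$;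 for $n=1$ it is called the Press–Dyson vectors. Memory-one ZD strategy of player $a$: a memory-one strategy whose Press–Dyson vectors satisfy $\sum_{\sigma_a}c_{\sigma_a}\hat T_a(\sigma_a|\bm\sigma^{(-1)})=\sum_{b=0}^N\alpha_b s_b(\bm\sigma^{(-1)})$ for all $\bm\sigma^{(-1)}$, with nontrivial real coefficients (not $c_1=\dots=c_{M_a}$, and not $\alpha_0=\dots=\alpha_N=0$). Limit distribution: for $t\ge n$ let $P_t(\bm\sigma(t),\dots,\bm\sigma(t-n+1))$ be the marginal of $\mathbb P_t$ on the last $n$ profiles, and $$P^*(\bm\sigma^{(-1)},\dots,\bm\sigma^{(-n)})=\lim_{T\to\infty}\frac1T\sum_{t=n}^{T+n-1}P_t(\bm\sigma^{(-1)},\dots,\bm\sigma^{(-n)}),$$ where $\bm\sigma^{(-1)}$ is the most recent profile. It is assumed throughout that $P^*$ exists. $\langle\cdots\rangle^*$ denotes expectation with respect to $P^*(\bm\sigma^{(-1)},\dots,\bm\sigma^{(-n)})$. "Unilaterally enforces" means that, when player $a$ uses the stated strategy, the conclusion holds whatever the strategies of all other players are (these are arbitrary behavior strategies); which of two alternatives holds may depend on those strategies. Here $\delta_{\sigma,\sigma'}$ is the Kronecker delta and $\delta_{\bm\sigma,\hat{\bm\sigma}}=\prod_{b=1}^N\delta_{\sigma_b,\hat\sigma_b}$; an empty product equals $1$. *)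

theory Defs
  imports "HOL-Probability.Probability_Mass_Function"
begin

type_synonym profile = "nat \<Rightarrow> nat"

text \<open>
  Histories are listed with the most recent profile first. A behaviour strategy takes the
  history as its only argument: the round is one more than the length of the history.
\<close>

type_synonym history = "profile list"

type_synonym strategy = "history \<Rightarrow> nat pmf"

definition profiles :: "nat \<Rightarrow> (nat \<Rightarrow> nat) \<Rightarrow> profile set" where
  "profiles N M = (\<Pi>\<^sub>E b\<in>{1..N}. {1..M b})"

definition histories :: "nat \<Rightarrow> (nat \<Rightarrow> nat) \<Rightarrow> nat \<Rightarrow> history set" where
  "histories N M t = {h. length h = t \<and> set h \<subseteq> profiles N M}"

text \<open>\<open>prev w m\<close> is the profile played \<open>m\<close> rounds ago, for \<open>1 \<le> m \<le> length w\<close>.\<close>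

definition prev :: "history \<Rightarrow> nat \<Rightarrow> profile" where
  "prev w m = w ! (m - 1)"

definition payoff :: "(nat \<Rightarrow> profile \<Rightarrow> real) \<Rightarrow> nat \<Rightarrow> profile \<Rightarrow> real" where
  "payoff s b \<sigma> = (if b = 0 then 1 else s b \<sigma>)"

definition delta :: "nat \<Rightarrow> nat \<Rightarrow> real" where
  "delta x y = (if x = y then 1 else 0)"

definition profile_delta :: "nat \<Rightarrow> profile \<Rightarrow> profile \<Rightarrow> real" where
  "profile_delta N \<sigma> \<tau> = (\<Prod>b=1..N. delta (\<sigma> b) (\<tau> b))"

definition is_strategy :: "nat \<Rightarrow> (nat \<Rightarrow> nat) \<Rightarrow> nat \<Rightarrow> strategy \<Rightarrow> bool" where
  "is_strategy N M a S \<longleftrightarrow> (\<forall>t. \<forall>h\<in>histories N M t. set_pmf (S h) \<subseteq> {1..M a})"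

text \<open>A conditional probability of an action of player \<open>a\<close> given the last \<open>n\<close> profiles.\<close>

definition is_kernel ::
  "nat \<Rightarrow> (nat \<Rightarrow> nat) \<Rightarrow> nat \<Rightarrow> nat \<Rightarrow> (history \<Rightarrow> nat pmf) \<Rightarrow> bool" where
  "is_kernel N M a n K \<longleftrightarrow> (\<forall>w\<in>histories N M n. set_pmf (K w) \<subseteq> {1..M a})"

text \<open>Behaviour in rounds \<open>t \<le> n\<close> is unconstrained.\<close>

definition memory_strategy ::
  "nat \<Rightarrow> (nat \<Rightarrow> nat) \<Rightarrow> nat \<Rightarrow> nat \<Rightarrow> strategy \<Rightarrow> (history \<Rightarrow> nat pmf) \<Rightarrow> bool" where
  "memory_strategy N M a n S K \<longleftrightarrow>
     is_strategy N M a S \<and> is_kernel N M a n K \<and>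
     (\<forall>t>n. \<forall>h\<in>histories N M (t - 1). S h = K (take n h))"

definition press_dyson :: "nat \<Rightarrow> (history \<Rightarrow> nat pmf) \<Rightarrow> nat \<Rightarrow> history \<Rightarrow> real" where
  "press_dyson a K x w = pmf (K w) x - delta x (prev w 1 a)"

definition memory_one_ZD ::
  "nat \<Rightarrow> (nat \<Rightarrow> nat) \<Rightarrow> (nat \<Rightarrow> profile \<Rightarrow> real) \<Rightarrow> nat \<Rightarrow> strategy \<Rightarrow> (history \<Rightarrow> nat pmf) \<Rightarrow>
    (nat \<Rightarrow> real) \<Rightarrow> (nat \<Rightarrow> real) \<Rightarrow> bool" where
  "memory_one_ZD N M s a S K c \<alpha> \<longleftrightarrow>
     memory_strategy N M a 1 S K \<and>
     (\<forall>\<sigma>\<in>profiles N M.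
        (\<Sum>x=1..M a. c x * press_dyson a K x [\<sigma>]) = (\<Sum>b=0..N. \<alpha> b * payoff s b \<sigma>)) \<and>
     \<not> (\<forall>x\<in>{1..M a}. \<forall>y\<in>{1..M a}. c x = c y) \<and>
     \<not> (\<forall>b\<in>{0..N}. \<alpha> b = 0)"

text \<open>
  In a history \<open>h\<close> of length \<open>t\<close>, round \<open>u\<close> is played at position \<open>t - u\<close>, and
  \<open>drop (t - u + 1) h\<close> is the history of the rounds before \<open>u\<close>.
\<close>

definition joint_prob :: "nat \<Rightarrow> (nat \<Rightarrow> strategy) \<Rightarrow> nat \<Rightarrow> history \<Rightarrow> real" where
  "joint_prob N T t h =
     (\<Prod>u=1..t. \<Prod>b=1..N. pmf (T b (drop (t - u + 1) h)) ((h ! (t - u)) b))"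

definition marginal_prob ::
  "nat \<Rightarrow> (nat \<Rightarrow> nat) \<Rightarrow> (nat \<Rightarrow> strategy) \<Rightarrow> nat \<Rightarrow> nat \<Rightarrow> history \<Rightarrow> real" where
  "marginal_prob N M T n t w =
     (\<Sum>h\<in>{h\<in>histories N M t. take n h = w}. joint_prob N T t h)"

definition time_average ::
  "nat \<Rightarrow> (nat \<Rightarrow> nat) \<Rightarrow> (nat \<Rightarrow> strategy) \<Rightarrow> nat \<Rightarrow> history \<Rightarrow> nat \<Rightarrow> real" where
  "time_average N M T n w L = 1 / real L * (\<Sum>t=n..L + n - 1. marginal_prob N M T n t w)"

definition limit_exists ::
  "nat \<Rightarrow> (nat \<Rightarrow> nat) \<Rightarrow> (nat \<Rightarrow> strategy) \<Rightarrow> nat \<Rightarrow> bool" where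
  "limit_exists N M T n \<longleftrightarrow> (\<forall>w\<in>histories N M n. convergent (time_average N M T n w))"

definition limit_prob ::
  "nat \<Rightarrow> (nat \<Rightarrow> nat) \<Rightarrow> (nat \<Rightarrow> strategy) \<Rightarrow> nat \<Rightarrow> history \<Rightarrow> real" where
  "limit_prob N M T n w = lim (time_average N M T n w)"

definition limit_expectation ::
  "nat \<Rightarrow> (nat \<Rightarrow> nat) \<Rightarrow> (nat \<Rightarrow> strategy) \<Rightarrow> nat \<Rightarrow> (history \<Rightarrow> real) \<Rightarrow> real" where
  "limit_expectation N M T n f = (\<Sum>w\<in>histories N M n. limit_prob N M T n w * f w)"

text \<open>
  The relation \<open>R\<close> is a property of the whole strategy profile. The limit distribution of the
  last \<open>n\<close> profiles is assumed to exist for the profiles considered.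
\<close>

definition unilaterally_enforces ::
  "nat \<Rightarrow> (nat \<Rightarrow> nat) \<Rightarrow> nat \<Rightarrow> nat \<Rightarrow> strategy \<Rightarrow> ((nat \<Rightarrow> strategy) \<Rightarrow> bool) \<Rightarrow> bool" where
  "unilaterally_enforces N M n a S R \<longleftrightarrow>
     (\<forall>T. T a = S \<longrightarrow> (\<forall>b\<in>{1..N}. is_strategy N M b (T b)) \<longrightarrow> limit_exists N M T n \<longrightarrow> R T)"

definition history_delta :: "nat \<Rightarrow> nat \<Rightarrow> (nat \<Rightarrow> profile) \<Rightarrow> history \<Rightarrow> real" where
  "history_delta N n \<tau> w = (\<Prod>m=2..n. profile_delta N (prev w m) (\<tau> m))"

text \<open>
  For every memory-one kernel \<open>K1\<close> and every choice of reference profiles, a memory-\<open>n\<close> strategy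
  with the restricted Press--Dyson tensor exists.
\<close>

lemma restricted_press_dyson_exists:
  assumes "a \<in> {1..N}" "n \<ge> 1" "is_strategy N M a S1" "is_kernel N M a 1 K1"
  shows "\<exists>S K. memory_strategy N M a n S K \<and>
    (\<forall>x\<in>{1..M a}. \<forall>w\<in>histories N M n.
       press_dyson a K x w = press_dyson a K1 x [prev w 1] * history_delta N n \<tau> w)"
proof -
  define K where "K = (\<lambda>w. if history_delta N n \<tau> w = 1 then K1 [prev w 1]
    else return_pmf (prev w 1 a))"
  define S where "S = (\<lambda>h. if length h \<ge> n then K (take n h) else S1 h)"
  have hd: "history_delta N n \<tau> w = 0 \<or> history_delta N n \<tau> w = 1" for w
  proof (cases "\<exists>m\<in>{2..n}. \<exists>b\<in>{1..N}. prev w m b \<noteq> \<tau> m b")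
    case True
    then have "\<exists>m\<in>{2..n}. profile_delta N (prev w m) (\<tau> m) = 0"
      unfolding profile_delta_def delta_def by (fastforce intro: prod_zero)
    then show ?thesis unfolding history_delta_def by (auto intro: prod_zero)
  next
    case False
    then show ?thesis unfolding history_delta_def profile_delta_def delta_def by simp
  qed
  have ker: "set_pmf (K w) \<subseteq> {1..M a}" if w: "w \<in> histories N M n" for w
  proof -
    have p: "prev w 1 \<in> profiles N M"
      using w assms(2) by (cases w) (auto simp: histories_def prev_def)
    then have "[prev w 1] \<in> histories N M 1" by (simp add: histories_def)
    then have "set_pmf (K1 [prev w 1]) \<subseteq> {1..M a}"
      using assms(4) unfolding is_kernel_def by blast
    moreover have "prev w 1 a \<in> {1..M a}"
      using p assms(1) by (auto simp: profiles_def dest: PiE_mem)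
    ultimately show ?thesis unfolding K_def by simp
  qed
  have "set_pmf (S h) \<subseteq> {1..M a}" if h: "h \<in> histories N M t" for h t
  proof (cases "n \<le> length h")
    case True
    then have "take n h \<in> histories N M n"
      using h set_take_subset[of n h] by (auto simp: histories_def)
    then show ?thesis using ker True by (simp add: S_def)
  next
    case False
    have "set_pmf (S1 h) \<subseteq> {1..M a}" using h assms(3) unfolding is_strategy_def by blast
    then show ?thesis using False by (simp add: S_def)
  qed
  then have "memory_strategy N M a n S K"
    using ker unfolding memory_strategy_def is_strategy_def is_kernel_def
    by (auto simp: S_def histories_def)
  moreover have "press_dyson a K x w = press_dyson a K1 x [prev w 1] * history_delta N n \<tau> w"
    for x w
    using hd[of w] by (auto simp: press_dyson_def K_def prev_def delta_def pmf_return)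
  ultimately show ?thesis by blast
qed

end

theory Submission imports Defs begin

text \<open>
  The idea is the telescoping argument of Press, Dyson and Akin. If \<open>q t\<close> is the
  probability that player \<open>a\<close> plays \<open>x\<close> in round \<open>t\<close>, then
  a Press--Dyson tensor records the one-round change of \<open>q\<close>: from round \<open>n\<close> on, the
  strategy reads only the last \<open>n\<close> profiles, so the mean of
  \<open>pmf (K w) x - delta x (prev w 1 a)\<close> over the last \<open>n\<close> profiles after round \<open>t\<close> is
  \<open>q (t + 1) - q t\<close>, whatever the other players do (\<open>mean_press_dyson\<close>). Averaged over
  \<open>L\<close> rounds the changes telescope to \<open>(q (L + n) - q n) / L\<close>, which vanishes in the limit
  because probabilities are bounded. Hence every component of the Press--Dyson tensor has
  expectation zero under the limit distribution (\<open>limit_expectation_press_dyson\<close>).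

  Here the tensor is the memory-one tensor times the indicator of the reference history. Taking
  the combination with coefficients \<open>c\<close> therefore turns the zero-determinant equation into a
  linear relation between the limit expectations of the payoffs restricted to that indicator.
  Either the indicator has expectation zero, or dividing by its expectation gives the relation
  between conditional expectations.
\<close>

definition history_mean ::
  "nat \<Rightarrow> (nat \<Rightarrow> nat) \<Rightarrow> (nat \<Rightarrow> strategy) \<Rightarrow> nat \<Rightarrow> (history \<Rightarrow> real) \<Rightarrow> real" where
  "history_mean N M T t f = (\<Sum>h\<in>histories N M t. joint_prob N T t h * f h)"

lemma finite_profiles: "finite (profiles N M)"
  unfolding profiles_def by (intro finite_PiE) auto

lemma finite_histories: "finite (histories N M t)"
  using finite_lists_length_eq[OF finite_profiles[of N M], of t]
  by (simp add: histories_def conj_commute)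

lemma take_in_histories:
  assumes "h \<in> histories N M t" "n \<le> t"
  shows "take n h \<in> histories N M n"
  using assms set_take_subset[of n h] by (auto simp: histories_def)

lemma joint_prob_Cons:
  "joint_prob N T (Suc t) (\<sigma> # h) = joint_prob N T t h * (\<Prod>b=1..N. pmf (T b h) (\<sigma> b))"
proof -
  have "(\<Prod>u=1..t. \<Prod>b=1..N. pmf (T b (drop (Suc t - u + 1) (\<sigma> # h))) (((\<sigma> # h) ! (Suc t - u)) b))
      = joint_prob N T t h"
    unfolding joint_prob_def by (intro prod.cong refl) (auto simp: Suc_diff_le)
  then show ?thesis
    by (simp add: joint_prob_def)
qed

lemma joint_prob_nonneg: "joint_prob N T t h \<ge> 0"
  unfolding joint_prob_def by (intro prod_nonneg ballI) auto

lemma history_mean_Suc: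
  "history_mean N M T (Suc t) f =
    history_mean N M T t
      (\<lambda>h. \<Sum>\<sigma>\<in>profiles N M. (\<Prod>b=1..N. pmf (T b h) (\<sigma> b)) * f (\<sigma> # h))"
proof -
  have "bij_betw (\<lambda>(h, \<sigma>). \<sigma> # h) (histories N M t \<times> profiles N M) (histories N M (Suc t))"
    unfolding bij_betw_def
    by (auto simp: inj_on_def histories_def length_Suc_conv image_iff)
  then have "history_mean N M T (Suc t) f =
      (\<Sum>(h, \<sigma>)\<in>histories N M t \<times> profiles N M. joint_prob N T (Suc t) (\<sigma> # h) * f (\<sigma> # h))"
    unfolding history_mean_def by (simp add: sum.reindex_bij_betw[symmetric] case_prod_beta)
  then show ?thesis
    by (simp add: joint_prob_Cons history_mean_def sum.cartesian_product[symmetric]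
        sum_distrib_left mult.assoc)
qed

lemma sum_pmf_actions:
  assumes "is_strategy N M b S" "h \<in> histories N M t"
  shows "(\<Sum>x=1..M b. pmf (S h) x) = 1"
  using assms by (intro sum_pmf_eq_1) (auto simp: is_strategy_def)

text \<open>The players randomise independently, so the law of a round is a product over the players
  and summing out the profile factorises.\<close>

lemma sum_profiles_prod:
  fixes g :: "nat \<Rightarrow> nat \<Rightarrow> real"
  shows "(\<Sum>\<sigma>\<in>profiles N M. \<Prod>b=1..N. g b (\<sigma> b)) = (\<Prod>b=1..N. \<Sum>x=1..M b. g b x)"
  unfolding profiles_def by (rule prod_sum_PiE[symmetric]) auto

lemma next_action_prob:
  assumes "\<forall>b\<in>{1..N}. is_strategy N M b (T b)" "h \<in> histories N M t"
    and "a \<in> {1..N}" "x \<in> {1..M a}"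
  shows "(\<Sum>\<sigma>\<in>profiles N M. (\<Prod>b=1..N. pmf (T b h) (\<sigma> b)) * delta x (\<sigma> a)) = pmf (T a h) x"
proof -
  define g where "g = (\<lambda>b y. pmf (T b h) y * (if b = a then delta x y else 1))"
  have "(\<Prod>b=1..N. pmf (T b h) (\<sigma> b)) * delta x (\<sigma> a) = (\<Prod>b=1..N. g b (\<sigma> b))" for \<sigma>
  proof -
    have "(\<Prod>b=1..N. if b = a then delta x (\<sigma> b) else 1) = delta x (\<sigma> a)"
      using assms(3) by (subst prod.delta) auto
    then show ?thesis unfolding g_def prod.distrib by simp
  qed
  moreover have "(\<Sum>y=1..M b. g b y) = (if b = a then pmf (T a h) x else 1)"
    if "b \<in> {1..N}" for b
  proof (cases "b = a")
    case True
    have "(\<Sum>y=1..M a. pmf (T a h) y * delta x y)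
        = (\<Sum>y=1..M a. if x = y then pmf (T a h) y else 0)"
      by (intro sum.cong) (auto simp: delta_def)
    then show ?thesis using True assms(4) by (simp add: g_def)
  next
    case False
    then show ?thesis using sum_pmf_actions[of N M b "T b" h t] assms(1,2) that by (simp add: g_def)
  qed
  ultimately show ?thesis
    using assms(3) by (simp add: sum_profiles_prod[where g = g, simplified] prod.delta)
qed

lemma history_mean_one:
  assumes "\<forall>b\<in>{1..N}. is_strategy N M b (T b)"
  shows "history_mean N M T t (\<lambda>_. 1) = 1"
proof (induction t)
  case 0
  have "histories N M 0 = {[]}" by (auto simp: histories_def)
  then show ?case by (simp add: history_mean_def joint_prob_def)
next
  case (Suc t)
  have "(\<Sum>\<sigma>\<in>profiles N M. \<Prod>b=1..N. pmf (T b h) (\<sigma> b)) = 1" if "h \<in> histories N M t" for h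
    unfolding sum_profiles_prod[where g = "\<lambda>b. pmf (T b h)"]
    using sum_pmf_actions[OF _ that] assms by (intro prod.neutral) auto
  then have "history_mean N M T (Suc t) (\<lambda>_. 1) = history_mean N M T t (\<lambda>_. 1)"
    unfolding history_mean_Suc by (simp add: history_mean_def)
  then show ?case using Suc by simp
qed

lemma history_mean_in_unit_interval:
  assumes "\<forall>b\<in>{1..N}. is_strategy N M b (T b)" "\<And>h. f h \<in> {0..1}"
  shows "history_mean N M T t f \<in> {0..1}"
proof -
  have "history_mean N M T t f \<le> history_mean N M T t (\<lambda>_. 1)"
    unfolding history_mean_def using assms(2)
    by (intro sum_mono mult_left_mono joint_prob_nonneg) auto
  moreover have "history_mean N M T t f \<ge> 0"
    unfolding history_mean_def using assms(2)
    by (intro sum_nonneg mult_nonneg_nonneg joint_prob_nonneg) auto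
  ultimately show ?thesis using history_mean_one[OF assms(1)] by simp
qed

lemma sum_marginal_prob:
  assumes "n \<le> t"
  shows "(\<Sum>w\<in>histories N M n. marginal_prob N M T n t w * f w)
    = history_mean N M T t (\<lambda>h. f (take n h))"
proof -
  have "(\<Sum>w\<in>histories N M n. marginal_prob N M T n t w * f w)
      = (\<Sum>w\<in>histories N M n. \<Sum>h\<in>{h\<in>histories N M t. take n h = w}.
           joint_prob N T t h * f (take n h))"
    unfolding marginal_prob_def sum_distrib_right by (intro sum.cong) auto
  also have "\<dots> = history_mean N M T t (\<lambda>h. f (take n h))"
    unfolding history_mean_def using assms
    by (intro sum.group finite_histories) (auto intro: take_in_histories)
  finally show ?thesis .
qed

text \<open>The first term of the Press--Dyson tensor predicts the action of round \<open>t + 1\<close>, the second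
  one observes the action of round \<open>t\<close>; averaging over the past leaves the difference of their
  probabilities, and the strategies of the other players cancel by normalisation.\<close>

lemma mean_press_dyson:
  assumes "a \<in> {1..N}" "x \<in> {1..M a}" "1 \<le> n" "n \<le> t"
    and "\<forall>b\<in>{1..N}. is_strategy N M b (T b)"
    and "memory_strategy N M a n (T a) K"
  shows "history_mean N M T t (\<lambda>h. press_dyson a K x (take n h)) =
    history_mean N M T (Suc t) (\<lambda>h. delta x (prev h 1 a)) -
    history_mean N M T t (\<lambda>h. delta x (prev h 1 a))"
proof -
  have "history_mean N M T (Suc t) (\<lambda>h. delta x (prev h 1 a))
      = history_mean N M T t (\<lambda>h. pmf (K (take n h)) x)"
    unfolding history_mean_Suc unfolding history_mean_def
  proof (intro sum.cong refl arg_cong2[where f = "(*)"])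
    fix h assume h: "h \<in> histories N M t"
    \<comment> \<open>After a history of length \<open>t\<close> comes round \<open>t + 1\<close>, which exceeds \<open>n\<close>.\<close>
    have "\<forall>u>n. \<forall>h\<in>histories N M (u - 1). T a h = K (take n h)"
      using assms(6) unfolding memory_strategy_def by blast
    from this[rule_format, of "Suc t" h] have "T a h = K (take n h)"
      using h assms(4) by simp
    then show "(\<Sum>\<sigma>\<in>profiles N M. (\<Prod>b=1..N. pmf (T b h) (\<sigma> b)) * delta x (prev (\<sigma> # h) 1 a))
        = pmf (K (take n h)) x"
      using next_action_prob[OF assms(5) h assms(1,2)] by (simp add: prev_def)
  qed
  then show ?thesis
    using assms(3) by (simp add: history_mean_def press_dyson_def prev_def
        right_diff_distrib sum_subtractf)
qed

lemma limit_expectation_tendsto: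
  assumes "limit_exists N M T n"
  shows "(\<lambda>L. \<Sum>w\<in>histories N M n. time_average N M T n w L * f w)
    \<longlonglongrightarrow> limit_expectation N M T n f"
  unfolding limit_expectation_def limit_prob_def
  using assms unfolding limit_exists_def
  by (intro tendsto_sum tendsto_mult_right) (auto simp: convergent_LIMSEQ_iff)

text \<open>This generalises Akin's lemma from memory-one to memory-\<open>n\<close> strategies: a telescoping sum of
  bounded terms disappears in a time average.\<close>

lemma limit_expectation_press_dyson:
  assumes "a \<in> {1..N}" "x \<in> {1..M a}" "1 \<le> n"
    and "\<forall>b\<in>{1..N}. is_strategy N M b (T b)"
    and "memory_strategy N M a n (T a) K"
    and "limit_exists N M T n"
  shows "limit_expectation N M T n (press_dyson a K x) = 0"
proof -
  define q where "q = (\<lambda>t. history_mean N M T t (\<lambda>h. delta x (prev h 1 a)))"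
  have average: "(\<Sum>w\<in>histories N M n. time_average N M T n w L * press_dyson a K x w)
      = (q (L + n) - q n) / real L" for L
  proof -
    have "(\<Sum>w\<in>histories N M n. time_average N M T n w L * press_dyson a K x w)
        = (\<Sum>t=n..L + n - 1. \<Sum>w\<in>histories N M n.
             marginal_prob N M T n t w * press_dyson a K x w) / real L"
      unfolding time_average_def
      by (subst sum.swap) (simp add: sum_divide_distrib sum_distrib_right)
    also have "\<dots> = (\<Sum>t=n..L + n - 1. q (Suc t) - q t) / real L"
      unfolding q_def using assms
      by (intro arg_cong2[where f = "(/)"] sum.cong refl) (simp add: sum_marginal_prob mean_press_dyson)
    also have "{n..L + n - 1} = {n..<L + n}"
      using assms(3) by auto
    also have "(\<Sum>t=n..<L + n. q (Suc t) - q t) = q (L + n) - q n"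
      by (rule sum_Suc_diff') simp
    finally show ?thesis .
  qed
  have "q t \<in> {0..1}" for t
    unfolding q_def using assms(4)
    by (intro history_mean_in_unit_interval) (auto simp: delta_def)
  then have "\<bar>q (L + n) - q n\<bar> \<le> 1" for L
    by (smt (verit) atLeastAtMost_iff)
  then have "(\<lambda>L. (q (L + n) - q n) / real L) \<longlonglongrightarrow> 0"
    by (intro tendsto_rabs_zero_cancel[OF tendsto_sandwich[OF _ _ tendsto_const lim_1_over_n]])
       (auto intro!: always_eventually divide_right_mono)
  with limit_expectation_tendsto[OF assms(6), of "press_dyson a K x"] show ?thesis
    unfolding average by (rule LIMSEQ_unique)
qed

lemma limit_expectation_sum:
  "limit_expectation N M T n (\<lambda>w. \<Sum>i\<in>I. r i * f i w) =
    (\<Sum>i\<in>I. r i * limit_expectation N M T n (f i))"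
  unfolding limit_expectation_def sum_distrib_left
  by (subst sum.swap) (simp add: mult.left_commute)

lemma limit_expectation_cong:
  assumes "\<And>w. w \<in> histories N M n \<Longrightarrow> f w = g w"
  shows "limit_expectation N M T n f = limit_expectation N M T n g"
  unfolding limit_expectation_def using assms by simp

lemma prev_in_profiles:
  assumes "w \<in> histories N M n" "1 \<le> m" "m \<le> n"
  shows "prev w m \<in> profiles N M"
  using assms nth_mem[of "m - 1" w] by (auto simp: histories_def prev_def)

theorem corollary2:
  fixes N :: nat and M :: "nat \<Rightarrow> nat" and s :: "nat \<Rightarrow> profile \<Rightarrow> real"
    and a n :: nat
    and S1 S :: strategy and K1 K :: "history \<Rightarrow> nat pmf"
    and c \<alpha> :: "nat \<Rightarrow> real" and \<tau> :: "nat \<Rightarrow> profile"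
  assumes "a \<in> {1..N}" and "n \<ge> 1"
    and "memory_one_ZD N M s a S1 K1 c \<alpha>"
    and "\<forall>m\<in>{2..n}. \<tau> m \<in> profiles N M"
    and "memory_strategy N M a n S K"
    and "\<forall>x\<in>{1..M a}. \<forall>w\<in>histories N M n.
           press_dyson a K x w = press_dyson a K1 x [prev w 1] * history_delta N n \<tau> w"
  shows "unilaterally_enforces N M n a S (\<lambda>T.
           (limit_expectation N M T n (history_delta N n \<tau>) \<noteq> 0 \<and>
            0 = (\<Sum>b=0..N. \<alpha> b *
                  (limit_expectation N M T n (\<lambda>w. payoff s b (prev w 1) * history_delta N n \<tau> w)
                   / limit_expectation N M T n (history_delta N n \<tau>)))) \<or>
           0 = limit_expectation N M T n (history_delta N n \<tau>))"
  unfolding unilaterally_enforces_def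
proof (intro allI impI)
  fix T
  assume "T a = S" and strategies: "\<forall>b\<in>{1..N}. is_strategy N M b (T b)"
    and limit: "limit_exists N M T n"
  let ?E = "limit_expectation N M T n" and ?\<delta> = "history_delta N n \<tau>"
  have ZD: "(\<Sum>x=1..M a. c x * press_dyson a K1 x [\<sigma>]) = (\<Sum>b=0..N. \<alpha> b * payoff s b \<sigma>)"
    if "\<sigma> \<in> profiles N M" for \<sigma>
    using assms(3) that unfolding memory_one_ZD_def by blast
  have tensor: "(\<Sum>x=1..M a. c x * press_dyson a K x w)
      = (\<Sum>b=0..N. \<alpha> b * (payoff s b (prev w 1) * ?\<delta> w))" if w: "w \<in> histories N M n" for w
  proof -
    have "(\<Sum>x=1..M a. c x * press_dyson a K x w)
        = (\<Sum>x=1..M a. c x * press_dyson a K1 x [prev w 1]) * ?\<delta> w"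
      using assms(6) w by (simp add: sum_distrib_right mult.assoc)
    also have "\<dots> = (\<Sum>b=0..N. \<alpha> b * payoff s b (prev w 1)) * ?\<delta> w"
      using ZD[OF prev_in_profiles[OF w]] assms(2) by simp
    finally show ?thesis
      by (simp add: sum_distrib_right mult.assoc)
  qed
  have "0 = (\<Sum>x=1..M a. c x * ?E (press_dyson a K x))"
    using limit_expectation_press_dyson[OF assms(1) _ assms(2) strategies _ limit] assms(5) \<open>T a = S\<close>
    by simp
  also have "\<dots> = ?E (\<lambda>w. \<Sum>b=0..N. \<alpha> b * (payoff s b (prev w 1) * ?\<delta> w))"
    unfolding limit_expectation_sum[symmetric] by (rule limit_expectation_cong) (rule tensor)
  also have "\<dots> = (\<Sum>b=0..N. \<alpha> b * ?E (\<lambda>w. payoff s b (prev w 1) * ?\<delta> w))"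
    by (rule limit_expectation_sum)
  finally have "0 = (\<Sum>b=0..N. \<alpha> b * (?E (\<lambda>w. payoff s b (prev w 1) * ?\<delta> w) / ?E ?\<delta>))"
    by (simp add: sum_divide_distrib[symmetric])
  then show "(?E ?\<delta> \<noteq> 0 \<and>
      0 = (\<Sum>b=0..N. \<alpha> b * (?E (\<lambda>w. payoff s b (prev w 1) * ?\<delta> w) / ?E ?\<delta>))) \<or> 0 = ?E ?\<delta>"
    by metis
qed

end
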